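(* Let $\alpha\in(0,1]$ and let $\mathbf p_1,\dots,\mathbf p_m$ be p-values for $H_1,\dots,H_m$. If the p-values satisfy PRDN in $M$, then the simultaneous closed Su procedure $\boldsymbol{\mathcal R}^{\overline{\mathrm{Su}}}_\alpha$ controls FDR (simultaneously) at level $\alpha$: $\mathbb E_{\mathrm P}\big(\max_{R\in\boldsymbol{\mathcal R}^{\overline{\mathrm{Su}}}_\alpha}\mathrm{FDP}_{N_{\mathrm P}}(R)\big)\le\alpha$ for every $\mathrm P\in M$. For $\alpha\in(0,1)$ and $m>1$, $\boldsymbol{\mathcal R}^{\overline{\mathrm{Su}}}_\alpha$ uniformly improves the Su procedure $\mathbf R^{\mathrm{Su}}_\alpha$ in both power and simultaneity.
   Context: Setting: $M$ is a set of probability measures on a measurable space; $m\ge 1$, $[m]=\{1,\dots,m\}$; hypotheses $H_1,\dots,H_m\subseteq M$; $N_{\mathrm P}=\{i\in[m]:\mathrm P\in H_i\}$. $\mathrm{FDP}_S(R)=|R\cap S|/(|R|\vee1)$. A random variable $\mathbf p_i\in[0,1]$ is a p-value for $H_i$ if $\mathrm P(\mathbf p_i\le t)\le t$ for all $t\in[0,1]$, $\mathrm P\in H_i$. PRDN in $M$: for every $\mathrm P\in M$, every increasing (upward closed in the coordinatewise order) measurable set $A\subseteq\mathbb R^{|N_{\mathrm P}|}$ and every $i\in N_{\mathrm P}$, the probability $\mathrm P((\mathbf p_j)_{j\in N_{\mathrm P}}\in A\mid\mathbf p_i\le t)$ is weakly increasing in $t$ (over $t$ for which the conditioning event has positive probability).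 $\ell_\alpha=-w(-\alpha/e)$, where $w$ is the $-1$ branch of the Lambert W function and $e=\exp(1)$. Su procedure: let $\mathbf p_{(r)}$ be the $r$th smallest p-value and $\mathbf R^{(r)}$ the set of indices of the $r$ smallest p-values (ties broken by smallest index), $\mathbf R^{(0)}=\emptyset$. $\mathbf R^{\mathrm{Su}}_\alpha=\mathbf R^{(\mathbf r)}$ with $\mathbf r=\max\{r\in[m]:\mathbf p_{(r)}\le\alpha r/(m\ell_\alpha)\}$, $\mathbf r=0$ if no such $r$ exists (the Benjamini–Hochberg procedure at level $\alpha/\ell_\alpha$). Closed Su: for nonempty $S\subseteq[m]$, let $\mathbf p_{i:S}$ be the $i$th smallest among $(\mathbf p_j)_{j\in S}$, $\mathbf p_S=\min_{1\le i\le|S|}|S|\mathbf p_{i:S}/i$ (the Simes p-value), and $\mathbf e_S=(\ell_\alpha\mathbf p_S\vee\alpha)^{-1}$; $\mathbf e_\emptyset=0$. Then $\boldsymbol{\mathcal R}^{\overline{\mathrm{Su}}}_\alpha=\{R\in 2^{[m]}:\mathbf e_S\ge\mathrm{FDP}_S(R)/\alpha\text{ for all }S\in 2^{[m]}\}$. Definitions. For the improvement claims, both procedures are viewed as functions of the realization $x=(\mathbf p_1,\dots,\mathbf p_m)\in[0,1]^m$. Let $\boldsymbol{\mathcal R}(x)\subseteq 2^{[m]}$ be the collection returned by a simultaneous procedure and $\mathbf S(x)\subseteq[m]$ the set returned by a classical procedure at data realization $x$. $\boldsymbol{\mathcal R}$ is a uniform simultaneity improvement over $\mathbf S$ if $\mathbf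 S(x)\in\boldsymbol{\mathcal R}(x)$ for every $x$ and, for at least one $x$, $\boldsymbol{\mathcal R}(x)$ also contains a nonempty set $R\ne\mathbf S(x)$. It is a uniform power improvement if for every $x$ there is $R\in\boldsymbol{\mathcal R}(x)$ with $R\supseteq\mathbf S(x)$ and, for at least one $x$, $\boldsymbol{\mathcal R}(x)$ also contains a nonempty set $R\supsetneq\mathbf S(x)$. *)

theory Defs
  imports "HOL-Probability.Probability"
begin

text \<open>Hypotheses are indexed by \<open>{1..m}\<close>. A realization of the p-values is a function
  \<open>x :: nat \<Rightarrow> real\<close>, of which only the values at \<open>{1..m}\<close> matter.\<close>

text \<open>The branch \<open>w \<le> -1\<close> of the Lambert W function; the defining equation has a unique
  solution for \<open>-1/e \<le> y < 0\<close>, and the value is unspecified elsewhere.\<close>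

definition lambert_Wm1 :: "real \<Rightarrow> real" where
  "lambert_Wm1 y = (THE w. w \<le> -1 \<and> w * exp w = y)"

definition ell :: "real \<Rightarrow> real" where
  "ell \<alpha> = - lambert_Wm1 (- \<alpha> / exp 1)"

definition true_nulls :: "nat \<Rightarrow> (nat \<Rightarrow> 'a measure set) \<Rightarrow> 'a measure \<Rightarrow> nat set" where
  "true_nulls m H P = {i \<in> {1..m}. P \<in> H i}"

definition FDP :: "nat set \<Rightarrow> nat set \<Rightarrow> real" where
  "FDP S R = real (card (R \<inter> S)) / max (real (card R)) 1"

definition is_p_value :: "'a measure \<Rightarrow> 'a measure set \<Rightarrow> ('a \<Rightarrow> real) \<Rightarrow> bool" where
  "is_p_value \<Omega> H0 q \<longleftrightarrow>
     q \<in> borel_measurable \<Omega> \<and> (\<forall>\<omega>\<in>space \<Omega>. q \<omega> \<in> {0..1}) \<and>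
     (\<forall>P\<in>H0. \<forall>t\<in>{0..1}. \<P>(\<omega> in P. q \<omega> \<le> t) \<le> t)"

definition increasing_set :: "nat set \<Rightarrow> (nat \<Rightarrow> real) set \<Rightarrow> bool" where
  "increasing_set I A \<longleftrightarrow>
     A \<subseteq> (\<Pi>\<^sub>E j\<in>I. UNIV) \<and>
     (\<forall>x\<in>A. \<forall>y\<in>(\<Pi>\<^sub>E j\<in>I. UNIV). (\<forall>j\<in>I. x j \<le> y j) \<longrightarrow> y \<in> A)"

definition PRDN ::
  "'a measure set \<Rightarrow> nat \<Rightarrow> (nat \<Rightarrow> 'a measure set) \<Rightarrow> (nat \<Rightarrow> 'a \<Rightarrow> real) \<Rightarrow> bool" where
  "PRDN M m H p \<longleftrightarrow>
     (\<forall>P\<in>M. let N = true_nulls m H P in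
        \<forall>A\<in>sets (\<Pi>\<^sub>M j\<in>N. (borel :: real measure)). increasing_set N A \<longrightarrow>
          (\<forall>i\<in>N. mono_on {t. \<P>(\<omega> in P. p i \<omega> \<le> t) > 0}
             (\<lambda>t. \<P>(\<omega> in P. (\<lambda>j\<in>N. p j \<omega>) \<in> A \<bar> p i \<omega> \<le> t))))"

text \<open>The \<open>i\<close>th smallest of the values \<open>x j\<close>, \<open>j \<in> S\<close>, counted with multiplicity
  and starting from \<open>i = 1\<close>.\<close>

definition order_stat :: "(nat \<Rightarrow> real) \<Rightarrow> nat set \<Rightarrow> nat \<Rightarrow> real" where
  "order_stat x S i = sort (map x (sorted_list_of_set S)) ! (i - 1)"

text \<open>\<open>sort_key\<close> is stable, so ties are broken in favour of the smallest index.\<close>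

definition smallest_indices :: "nat \<Rightarrow> (nat \<Rightarrow> real) \<Rightarrow> nat \<Rightarrow> nat set" where
  "smallest_indices m x r = set (take r (sort_key x [1..<Suc m]))"

definition Su_count :: "nat \<Rightarrow> real \<Rightarrow> (nat \<Rightarrow> real) \<Rightarrow> nat" where
  "Su_count m \<alpha> x =
     (let K = {r \<in> {1..m}. order_stat x {1..m} r \<le> \<alpha> * real r / (real m * ell \<alpha>)}
      in if K = {} then 0 else Max K)"

definition Su :: "nat \<Rightarrow> real \<Rightarrow> (nat \<Rightarrow> real) \<Rightarrow> nat set" where
  "Su m \<alpha> x = smallest_indices m x (Su_count m \<alpha> x)"

definition simes :: "(nat \<Rightarrow> real) \<Rightarrow> nat set \<Rightarrow> real" where
  "simes x S = Min ((\<lambda>i. real (card S) * order_stat x S i / real i) ` {1..card S})"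

definition Su_e_value :: "real \<Rightarrow> (nat \<Rightarrow> real) \<Rightarrow> nat set \<Rightarrow> real" where
  "Su_e_value \<alpha> x S = (if S = {} then 0 else inverse (max (ell \<alpha> * simes x S) \<alpha>))"

definition closed_Su :: "nat \<Rightarrow> real \<Rightarrow> (nat \<Rightarrow> real) \<Rightarrow> nat set set" where
  "closed_Su m \<alpha> x =
     {R \<in> Pow {1..m}. \<forall>S\<in>Pow {1..m}. Su_e_value \<alpha> x S \<ge> FDP S R / \<alpha>}"

text \<open>The largest false discovery proportion among the sets in a finite nonempty
  collection; \<open>closed_Su\<close> always contains the empty set.\<close>

definition max_FDP :: "nat set \<Rightarrow> nat set set \<Rightarrow> real" where
  "max_FDP N \<R> = Max (FDP N ` \<R>)"

text \<open>Integrability is required explicitly because the Bochner integral of a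
  non-integrable function is \<open>0\<close>.\<close>

definition controls_FDR_simultaneously ::
  "'a measure set \<Rightarrow> nat \<Rightarrow> (nat \<Rightarrow> 'a measure set) \<Rightarrow> ('a \<Rightarrow> nat set set) \<Rightarrow> real \<Rightarrow> bool" where
  "controls_FDR_simultaneously M m H \<R> \<alpha> \<longleftrightarrow>
     (\<forall>P\<in>M. integrable P (\<lambda>\<omega>. max_FDP (true_nulls m H P) (\<R> \<omega>)) \<and>
            (\<integral>\<omega>. max_FDP (true_nulls m H P) (\<R> \<omega>) \<partial>P) \<le> \<alpha>)"

text \<open>In the following two definitions \<open>X\<close> is the set of possible data realizations.\<close>

definition uniform_simultaneity_improvement ::
  "'x set \<Rightarrow> ('x \<Rightarrow> nat set set) \<Rightarrow> ('x \<Rightarrow> nat set) \<Rightarrow> bool" where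
  "uniform_simultaneity_improvement X \<R> S \<longleftrightarrow>
     (\<forall>x\<in>X. S x \<in> \<R> x) \<and> (\<exists>x\<in>X. \<exists>R\<in>\<R> x. R \<noteq> {} \<and> R \<noteq> S x)"

definition uniform_power_improvement ::
  "'x set \<Rightarrow> ('x \<Rightarrow> nat set set) \<Rightarrow> ('x \<Rightarrow> nat set) \<Rightarrow> bool" where
  "uniform_power_improvement X \<R> S \<longleftrightarrow>
     (\<forall>x\<in>X. \<exists>R\<in>\<R> x. S x \<subseteq> R) \<and> (\<exists>x\<in>X. \<exists>R\<in>\<R> x. R \<noteq> {} \<and> S x \<subset> R)"

end

theory Submission imports Defs begin

text \<open>The set \<open>S\<close> of true nulls is one of the sets in the closure condition, so the largest
  \<open>FDP\<close> is at most \<open>\<alpha>\<close> times the e-value of \<open>S\<close>. Under PRDN the Simes p-value of \<open>S\<close> is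
  stochastically at least uniform, and \<open>1 / max (l U) \<alpha>\<close> with \<open>U\<close> uniform has expectation
  \<open>(1 + ln (l / \<alpha>)) / l\<close>, which is \<open>1\<close> precisely for \<open>l = ell \<alpha>\<close>.

  For the improvement, the set rejected by Su lies in the closed collection because its \<open>k\<close>
  elements in \<open>S\<close> already bound the Simes p-value of \<open>S\<close>. The improvement is strict when all
  p-values but one are \<open>0\<close> and the last is \<open>min 1 (m \<alpha> / l)\<close>.\<close>

section \<open>The constant \<open>ell\<close>\<close>

text \<open>Logarithms turn equality into \<open>ln (b / a) = b - a\<close>. But
  \<open>ln z < z - 1\<close> for \<open>z \<noteq> 1\<close>, and
  \<open>b / a - 1 = (b - a) / a \<le> b - a\<close> because \<open>1 \<le> a\<close>. This yields
  uniqueness on the \<open>-1\<close> branch.\<close>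

lemma mult_exp_uminus_inj:
  fixes a b :: real
  assumes "1 \<le> a" "a < b"
  shows "a * exp (- a) \<noteq> b * exp (- b)"
proof
  assume eq: "a * exp (- a) = b * exp (- b)"
  have "ln (a * exp (- a)) = ln a - a" "ln (b * exp (- b)) = ln b - b"
    using assms by (simp_all add: ln_mult)
  with eq have "ln (b / a) = b - a"
    using assms by (simp add: ln_div)
  moreover have "ln (b / a) < b / a - 1"
    using ln_eq_minus_one[of "b / a"] ln_le_minus_one[of "b / a"] assms
    by (fastforce simp: order_less_le)
  moreover have "b / a - 1 \<le> b - a"
  proof -
    have "(b - a) / a \<le> (b - a) / 1"
      using assms by (intro divide_left_mono) auto
    then show ?thesis
      using assms by (simp add: diff_divide_distrib)
  qed
  ultimately show False by simp
qed

lemma lambert_Wm1_props: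
  assumes "0 < y" "y \<le> exp (-1)"
  shows "lambert_Wm1 (- y) \<le> -1" "lambert_Wm1 (- y) * exp (lambert_Wm1 (- y)) = - y"
proof -
  \<comment> \<open>\<open>L\<close> is a right end point for the intermediate value theorem:
    \<open>exp L \<ge> L * L / 2\<close> and \<open>L \<ge> 2 / y\<close> give
    \<open>L * exp (- L) \<le> y\<close>, while the value at \<open>1\<close> is
    \<open>exp (-1) \<ge> y\<close>.\<close>
  define L where "L = max 1 (2 / y)"
  have L: "1 \<le> L" "2 / y \<le> L" by (auto simp: L_def)
  have "L * exp (- L) \<le> y"
  proof -
    have "L\<^sup>2 / 2 \<le> exp L"
      using exp_lower_Taylor_quadratic[of L] L by simp
    then have "L * L \<le> 2 * exp L" by (simp add: power2_eq_square)
    also have "\<dots> \<le> y * L * exp L"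
      using L(2) assms by (intro mult_right_mono) (auto simp: field_simps)
    finally have "L \<le> y * exp L" using L(1) by (simp add: mult.assoc mult.left_commute)
    then show ?thesis by (simp add: exp_minus field_simps)
  qed
  then have "\<exists>z\<ge>1. z \<le> L \<and> z * exp (- z) = y"
    using assms L(1) by (intro IVT2') (auto intro!: continuous_intros)
  then obtain z where z: "1 \<le> z" "z * exp (- z) = y" by blast
  have "\<exists>!w. w \<le> -1 \<and> w * exp w = - y"
  proof (rule ex1I[of _ "- z"])
    fix w assume w: "w \<le> -1 \<and> w * exp w = - y"
    then have "(- w) * exp (- (- w)) = z * exp (- z)" using z by simp
    then show "w = - z"
      using mult_exp_uminus_inj[of "- w" z] mult_exp_uminus_inj[of z "- w"] w z
      by (metis add.inverse_inverse le_minus_iff linorder_neqE_linordered_idom)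
  qed (use z in auto)
  from theI'[OF this] show "lambert_Wm1 (- y) \<le> -1"
    "lambert_Wm1 (- y) * exp (lambert_Wm1 (- y)) = - y"
    by (simp_all add: lambert_Wm1_def)
qed

text \<open>With \<open>w = - ell \<alpha>\<close>, the equation
  \<open>w * exp w = - \<alpha> / exp 1\<close> becomes the second claim after cancelling signs and
  multiplying by \<open>exp 1\<close>.\<close>

lemma ell_props:
  assumes "0 < \<alpha>" "\<alpha> \<le> 1"
  shows "1 \<le> ell \<alpha>" "\<alpha> = ell \<alpha> * exp (1 - ell \<alpha>)"
proof -
  have *: "0 < \<alpha> / exp 1" "\<alpha> / exp 1 \<le> exp (-1)"
    using assms by (simp_all add: exp_minus divide_simps)
  show "1 \<le> ell \<alpha>" "\<alpha> = ell \<alpha> * exp (1 - ell \<alpha>)"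
    using lambert_Wm1_props[OF *]
    by (simp_all add: ell_def exp_add exp_diff field_simps)
qed

lemma ell_eq:
  assumes "0 < \<alpha>" "\<alpha> \<le> 1"
  shows "ell \<alpha> = 1 + ln (ell \<alpha> / \<alpha>)"
proof -
  have "ln \<alpha> = ln (ell \<alpha> * exp (1 - ell \<alpha>))" using ell_props(2)[OF assms] by simp
  also have "\<dots> = ln (ell \<alpha>) + (1 - ell \<alpha>)"
    using ell_props(1)[OF assms] by (simp add: ln_mult)
  finally show ?thesis using ell_props(1)[OF assms] assms by (simp add: ln_div)
qed

lemma ell_gt:
  assumes "0 < \<alpha>" "\<alpha> < 1"
  shows "1 < ell \<alpha>"
  using ell_props[of \<alpha>] assms by (cases "ell \<alpha> = 1") auto

section \<open>Order statistics and the Simes p-value\<close>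

text \<open>In a sorted list the entries at most \<open>u\<close> form an initial segment, so their
  number decides which positions belong to it.\<close>

lemma sorted_nth_le_iff:
  fixes ys :: "'a :: linorder list"
  assumes "sorted ys" "k < length ys"
  shows "ys ! k \<le> u \<longleftrightarrow> k < length (filter (\<lambda>y. y \<le> u) ys)"
  using assms
proof (induction ys arbitrary: k)
  case (Cons y ys)
  show ?case
  proof (cases "y \<le> u")
    case True
    then show ?thesis using Cons by (cases k) auto
  next
    case False
    with Cons.prems have "\<forall>z\<in>set (y # ys). \<not> z \<le> u" by auto
    moreover from this have "\<not> (y # ys) ! k \<le> u" using Cons.prems(2) nth_mem by blast
    ultimately show ?thesis by (simp add: filter_empty_conv)
  qed
qed simp

text \<open>Trades order statistics for counts, whose measurability and monotonicity in the data are
  immediate.\<close>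

lemma order_stat_le_iff:
  assumes "finite S" "1 \<le> i" "i \<le> card S"
  shows "order_stat x S i \<le> u \<longleftrightarrow> i \<le> card {j \<in> S. x j \<le> u}"
proof -
  let ?xs = "sorted_list_of_set S"
  have "length (filter (\<lambda>y. y \<le> u) (sort (map x ?xs))) = length (filter (\<lambda>j. x j \<le> u) ?xs)"
    by (simp add: filter_sort filter_map o_def)
  also have "\<dots> = card (set (filter (\<lambda>j. x j \<le> u) ?xs))"
    by (rule distinct_card[symmetric]) simp
  also have "set (filter (\<lambda>j. x j \<le> u) ?xs) = {j \<in> S. x j \<le> u}"
    using assms by auto
  finally show ?thesis
    using sorted_nth_le_iff[of "sort (map x ?xs)" "i - 1" u] assms
    by (auto simp: order_stat_def)
qed

text \<open>The working form of the Simes p-value: a minimum is at most \<open>t\<close> if one of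
  its terms is, and each term is a statement about a count. The thresholds are linear in
  \<open>r\<close>, as in a step-up procedure.\<close>

lemma simes_le_iff:
  assumes "finite S" "S \<noteq> {}"
  shows "simes x S \<le> t \<longleftrightarrow>
    (\<exists>r\<in>{1..card S}. r \<le> card {j \<in> S. x j \<le> real r * t / real (card S)})"
proof -
  have pos: "0 < card S" using assms by (simp add: card_gt_0_iff)
  have "simes x S \<le> t \<longleftrightarrow> (\<exists>r\<in>{1..card S}. real (card S) * order_stat x S r / real r \<le> t)"
    unfolding simes_def using pos by (subst Min_le_iff) auto
  also have "\<dots> \<longleftrightarrow> (\<exists>r\<in>{1..card S}. order_stat x S r \<le> real r * t / real (card S))"
    using pos by (intro bex_cong refl) (auto simp: field_simps)
  also have "\<dots> \<longleftrightarrow> (\<exists>r\<in>{1..card S}. r \<le> card {j \<in> S. x j \<le> real r * t / real (card S)})"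
    using assms by (intro bex_cong refl order_stat_le_iff) auto
  finally show ?thesis .
qed

lemma simes_le_one:
  assumes "finite S" "S \<noteq> {}" "\<And>j. j \<in> S \<Longrightarrow> x j \<le> 1"
  shows "simes x S \<le> 1"
proof -
  have pos: "0 < card S" using assms by (simp add: card_gt_0_iff)
  have "{j \<in> S. x j \<le> real (card S) * 1 / real (card S)} = S" using assms pos by auto
  then have "card S \<le> card {j \<in> S. x j \<le> real (card S) * 1 / real (card S)}" by simp
  with pos show ?thesis
    unfolding simes_le_iff[OF assms(1,2)] by (intro bexI[of _ "card S"]) simp_all
qed

lemma simes_cong:
  assumes "finite S" "\<And>j. j \<in> S \<Longrightarrow> x j = y j"
  shows "simes x S = simes y S"
proof -
  have "map x (sorted_list_of_set S) = map y (sorted_list_of_set S)"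
    using assms by simp
  then have "order_stat x S i = order_stat y S i" for i by (simp only: order_stat_def)
  then show ?thesis by (simp only: simes_def)
qed

lemma Su_e_value_ge_iff:
  assumes "0 < \<alpha>" "finite S" "S \<noteq> {}"
  shows "c / \<alpha> \<le> Su_e_value \<alpha> x S \<longleftrightarrow> c * max (ell \<alpha> * simes x S) \<alpha> \<le> \<alpha>"
proof -
  have "0 < max (ell \<alpha> * simes x S) \<alpha>" using assms by auto
  then show ?thesis using assms by (simp add: Su_e_value_def field_simps)
qed

section \<open>Measurability\<close>

lemma measurable_count_le:
  assumes "finite S" "\<And>j. j \<in> S \<Longrightarrow> q j \<in> borel_measurable M"
  shows "Measurable.pred M (\<lambda>\<omega>. r \<le> card {j \<in> S. q j \<omega> \<le> (u::real)})"
proof -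
  have eq: "r \<le> card {j \<in> S. q j \<omega> \<le> u} \<longleftrightarrow>
      real r \<le> (\<Sum>j\<in>S. if q j \<omega> \<le> u then 1 else 0)" for \<omega>
  proof -
    have "(\<Sum>j\<in>S. if q j \<omega> \<le> u then 1 else 0) = real (card {j \<in> S. q j \<omega> \<le> u})"
      using assms(1) by (simp add: sum.If_cases Int_def)
    then show ?thesis by simp
  qed
  show ?thesis unfolding eq using assms(2) by measurable
qed

lemma borel_measurable_simes:
  assumes "finite S" "S \<noteq> {}" "\<And>j. j \<in> S \<Longrightarrow> q j \<in> borel_measurable M"
  shows "(\<lambda>\<omega>. simes (\<lambda>j. q j \<omega>) S) \<in> borel_measurable M"
proof (rule borel_measurableI_le)
  fix t
  show "{\<omega> \<in> space M. simes (\<lambda>j. q j \<omega>) S \<le> t} \<in> sets M"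
    unfolding simes_le_iff[OF assms(1,2)]
    using measurable_count_le[OF assms(1,3)] by measurable
qed

text \<open>The maximum runs over a random collection. It exceeds \<open>t\<close> exactly if some
  fixed \<open>R\<close> with \<open>FDP N R > t\<close> belongs to \<open>C \<omega>\<close>, which
  is a finite union of measurable events.\<close>

lemma borel_measurable_max_FDP:
  assumes "\<And>\<omega>. {} \<in> C \<omega>" "\<And>\<omega>. C \<omega> \<subseteq> Pow {1..m}"
    and meas: "\<And>R. R \<subseteq> {1..m} \<Longrightarrow> {\<omega> \<in> space M. R \<in> C \<omega>} \<in> sets M"
  shows "(\<lambda>\<omega>. max_FDP N (C \<omega>)) \<in> borel_measurable M"
proof (rule borel_measurableI_greater)
  fix t
  have "t < max_FDP N (C \<omega>) \<longleftrightarrow> (\<exists>R\<in>C \<omega>. t < FDP N R)" for \<omega>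
  proof -
    have "finite (C \<omega>)" "C \<omega> \<noteq> {}"
      using assms(1,2)[of \<omega>] by (auto intro: finite_subset)
    then show ?thesis by (simp add: max_FDP_def Max_gr_iff)
  qed
  then have "{\<omega> \<in> space M. t < max_FDP N (C \<omega>)} =
      {\<omega> \<in> space M. \<exists>R\<in>C \<omega>. t < FDP N R}" by simp
  also have "\<dots> = (\<Union>R\<in>{R \<in> Pow {1..m}. t < FDP N R}. {\<omega> \<in> space M. R \<in> C \<omega>})"
    (is "?L = ?R")
  proof (intro equalityI subsetI)
    fix \<omega> assume "\<omega> \<in> ?L"
    then show "\<omega> \<in> ?R" using assms(2)[of \<omega>] by auto
  qed auto
  also have "\<dots> \<in> sets M" using meas by (intro sets.finite_UN) auto
  finally show "{\<omega> \<in> space M. t < max_FDP N (C \<omega>)} \<in> sets M" .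
qed

lemma FDP_empty [simp]: "FDP S {} = 0" "FDP {} R = 0"
  by (simp_all add: FDP_def)

text \<open>A division-free form of membership. The condition for \<open>S = {}\<close> reads
  \<open>0 \<le> 0\<close> and drops out, so Simes p-values occur for nonempty sets only.\<close>

lemma closed_Su_iff:
  assumes "0 < \<alpha>"
  shows "R \<in> closed_Su m \<alpha> x \<longleftrightarrow> R \<subseteq> {1..m} \<and>
    (\<forall>S\<in>Pow {1..m} - {{}}. FDP S R * max (ell \<alpha> * simes x S) \<alpha> \<le> \<alpha>)"
proof -
  have "FDP S R / \<alpha> \<le> Su_e_value \<alpha> x S \<longleftrightarrow>
      S = {} \<or> FDP S R * max (ell \<alpha> * simes x S) \<alpha> \<le> \<alpha>" if "S \<subseteq> {1..m}" for S
    using that Su_e_value_ge_iff[OF assms, of S "FDP S R" x]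
    by (cases "S = {}") (auto simp: Su_e_value_def finite_subset)
  then have "(\<forall>S\<in>Pow {1..m}. FDP S R / \<alpha> \<le> Su_e_value \<alpha> x S) \<longleftrightarrow>
      (\<forall>S\<in>Pow {1..m}. S = {} \<or> FDP S R * max (ell \<alpha> * simes x S) \<alpha> \<le> \<alpha>)"
    by (intro ball_cong refl) (simp only: Pow_iff)
  also have "\<dots> \<longleftrightarrow>
      (\<forall>S\<in>Pow {1..m} - {{}}. FDP S R * max (ell \<alpha> * simes x S) \<alpha> \<le> \<alpha>)"
    by blast
  finally show ?thesis by (simp add: closed_Su_def)
qed

lemma empty_in_closed_Su: "0 < \<alpha> \<Longrightarrow> {} \<in> closed_Su m \<alpha> x"
  by (simp add: closed_Su_iff)

lemma closed_Su_measurable: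
  assumes "0 < \<alpha>" "\<And>j. j \<in> {1..m} \<Longrightarrow> q j \<in> borel_measurable M"
  shows "{\<omega> \<in> space M. R \<in> closed_Su m \<alpha> (\<lambda>j. q j \<omega>)} \<in> sets M"
proof -
  have *: "(\<lambda>\<omega>. simes (\<lambda>j. q j \<omega>) S) \<in> borel_measurable M" if "S \<in> Pow {1..m} - {{}}" for S
    using that assms(2) by (intro borel_measurable_simes) (auto simp: finite_subset)
  have "Measurable.pred M (\<lambda>\<omega>. FDP S R * max (ell \<alpha> * simes (\<lambda>j. q j \<omega>) S) \<alpha> \<le> \<alpha>)"
    if "S \<in> Pow {1..m} - {{}}" for S
    using *[OF that] by measurable
  then have "Measurable.pred M (\<lambda>\<omega>. \<forall>S\<in>Pow {1..m} - {{}}.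
      FDP S R * max (ell \<alpha> * simes (\<lambda>j. q j \<omega>) S) \<alpha> \<le> \<alpha>)"
    by (intro pred_intros_finite) auto
  then show ?thesis unfolding closed_Su_iff[OF assms(1)] by measurable
qed

section \<open>Improvement over the Su procedure\<close>

lemma Su_facts:
  assumes "0 < \<alpha>"
  shows "Su m \<alpha> x \<subseteq> {1..m}" "card (Su m \<alpha> x) = Su_count m \<alpha> x" "Su_count m \<alpha> x \<le> m"
    "\<And>i. i \<in> Su m \<alpha> x \<Longrightarrow> x i \<le> \<alpha> * real (Su_count m \<alpha> x) / (real m * ell \<alpha>)"
proof -
  define K where "K = {r \<in> {1..m}. order_stat x {1..m} r \<le> \<alpha> * real r / (real m * ell \<alpha>)}"
  define r where "r = Su_count m \<alpha> x"
  define L where "L = sort_key x [1..<Suc m]"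
  have r: "r = (if K = {} then 0 else Max K)" by (simp only: r_def Su_count_def K_def Let_def)
  have "finite K" by (simp add: K_def)
  then have "K = {} \<or> r \<in> K" using Max_in[of K] by (auto simp: r)
  \<comment> \<open>A positive count is an attained maximum, so it satisfies its own threshold
    inequality.\<close>
  then have rK: "r = 0 \<or> r \<in> K" by (metis r)
  show le: "Su_count m \<alpha> x \<le> m" using rK by (auto simp: r_def[symmetric] K_def)
  have Su: "Su m \<alpha> x = set (take r L)" by (simp add: Su_def smallest_indices_def r_def L_def)
  have L: "set L = {1..m}" "distinct L" "length L = m" by (auto simp: L_def)
  show "Su m \<alpha> x \<subseteq> {1..m}" using set_take_subset[of r L] L by (auto simp: Su)
  show "card (Su m \<alpha> x) = Su_count m \<alpha> x"
    using L le by (simp add: Su distinct_card r_def)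
  \<comment> \<open>Sorting indices by value and then reading off values gives the sorted values, so
    entry \<open>r - 1\<close> of this list is the \<open>r\<close>th order statistic.\<close>
  have map: "map x L = sort (map x [1..<Suc m])"
    by (rule properties_for_sort[symmetric]) (simp_all add: L_def)
  fix i assume "i \<in> Su m \<alpha> x"
  then obtain j where j: "j < r" "j < m" "i = L ! j"
    using L by (auto simp: Su in_set_conv_nth)
  with rK have "r \<in> K" by auto
  have "x i = map x L ! j" using j L by simp
  also have "\<dots> \<le> map x L ! (r - 1)"
    using j L le by (intro sorted_nth_mono) (auto simp: L_def r_def)
  also have "\<dots> = order_stat x {1..m} r"
    by (simp add: order_stat_def map atLeastLessThanSuc_atLeastAtMost[symmetric] del: upt_Suc)
  also have "\<dots> \<le> \<alpha> * real r / (real m * ell \<alpha>)" using \<open>r \<in> K\<close> by (simp add: K_def)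
  finally show "x i \<le> \<alpha> * real (Su_count m \<alpha> x) / (real m * ell \<alpha>)" by (simp add: r_def)
qed

text \<open>At least \<open>card T\<close> elements of \<open>S\<close> have value at most
  \<open>u\<close>, so \<open>card T\<close> serves as the witness \<open>r\<close> in
  \<open>simes_le_iff\<close>.\<close>

lemma simes_le_of_subset:
  assumes "finite S" "T \<subseteq> S" "T \<noteq> {}" "\<And>j. j \<in> T \<Longrightarrow> x j \<le> u"
  shows "simes x S \<le> real (card S) * u / real (card T)"
proof -
  have T: "finite T" "0 < card T" "card T \<le> card S"
    using assms by (auto simp: finite_subset card_gt_0_iff card_mono)
  have "S \<noteq> {}" using assms by blast
  have "card T \<le> card {j \<in> S. x j \<le> u}"
    using assms by (intro card_mono) auto
  moreover have "real (card T) * (real (card S) * u / real (card T)) / real (card S) = u"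
    using T by auto
  ultimately show ?thesis
    using assms T unfolding simes_le_iff[OF assms(1) \<open>S \<noteq> {}\<close>]
    by (intro bexI[of _ "card T"]) (simp_all only: atLeastAtMost_iff Suc_le_eq One_nat_def)
qed

lemma Su_in_closed_Su:
  assumes "0 < \<alpha>" "\<alpha> \<le> 1"
  shows "Su m \<alpha> x \<in> closed_Su m \<alpha> x"
  unfolding closed_Su_iff[OF assms(1)]
proof (intro conjI ballI)
  let ?R = "Su m \<alpha> x" and ?l = "ell \<alpha>"
  note Su = Su_facts[OF assms(1), where m = m and x = x]
  have l: "1 \<le> ?l" using ell_props assms by blast
  show "?R \<subseteq> {1..m}" by (rule Su)
  fix S assume S: "S \<in> Pow {1..m} - {{}}"
  then have fS: "finite S" by (auto simp: finite_subset)
  show "FDP S ?R * max (?l * simes x S) \<alpha> \<le> \<alpha>"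
  proof (cases "?R \<inter> S = {}")
    case True
    then show ?thesis using assms by (simp add: FDP_def)
  next
    case False
    \<comment> \<open>The aim is to bound both arguments of the maximum by
      \<open>\<alpha> * r / k\<close>: the Simes term through the \<open>k\<close> rejected elements
      of \<open>S\<close> and \<open>card S \<le> m\<close>, the constant \<open>\<alpha>\<close>
      through \<open>k \<le> r\<close>. The factor \<open>k / r\<close> is the \<open>FDP\<close>
      and cancels.\<close>
    define k r where "k = card (?R \<inter> S)" and "r = card ?R"
    have finR: "finite ?R" using Su(1) by (rule finite_subset) simp
    have k: "0 < k" "k \<le> r"
      using False finR fS by (auto simp: k_def r_def card_gt_0_iff intro: card_mono)
    have "card S \<le> m" using S card_mono[of "{1..m}" S] by auto
    have m: "0 < m" using k Su(2,3) by (simp add: r_def)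
    have "simes x S \<le> real (card S) * (\<alpha> * real r / (real m * ?l)) / real k"
      unfolding k_def using Su(2,4) False fS by (intro simes_le_of_subset) (auto simp: r_def)
    also have "\<dots> \<le> real m * (\<alpha> * real r / (real m * ?l)) / real k"
      using \<open>card S \<le> m\<close> assms l by (intro divide_right_mono mult_right_mono) auto
    also have "\<dots> = \<alpha> * r / (?l * k)" using m by simp
    finally have "?l * simes x S \<le> \<alpha> * r / k" using l k by (simp add: field_simps)
    moreover have "\<alpha> \<le> \<alpha> * r / k" using k assms by (simp add: field_simps)
    ultimately have "max (?l * simes x S) \<alpha> \<le> \<alpha> * r / k" by simp
    then have "(real k / real r) * max (?l * simes x S) \<alpha> \<le> (real k / real r) * (\<alpha> * r / k)"
      by (rule mult_left_mono) simp
    also have "\<dots> = \<alpha>" using k by simp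
    also have "real k / real r = FDP S ?R"
      using k by (simp add: FDP_def k_def r_def)
    finally show ?thesis .
  qed
qed

lemma strict_improvement_exists:
  assumes "0 < \<alpha>" "\<alpha> < 1" "1 < m"
  shows "\<exists>x\<in>\<Pi>\<^sub>E i\<in>{1..m}. {0..1}. {1..m} \<in> closed_Su m \<alpha> x \<and> Su m \<alpha> x \<subset> {1..m}"
proof -
  have l: "1 < ell \<alpha>" using ell_gt assms by blast
  \<comment> \<open>Two demands meet in \<open>y\<close>:
    \<open>ell \<alpha> * y \<le> m * \<alpha>\<close> satisfies the closure condition at
    \<open>S = {m}\<close>, where the \<open>FDP\<close> is only \<open>1 / m\<close>, and
    \<open>y > \<alpha> / ell \<alpha>\<close> puts it above every Su threshold.\<close>
  define y where "y = min 1 (real m * \<alpha> / ell \<alpha>)"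
  define x where "x = (\<lambda>i\<in>{1..m}. if i = m then y else 0)"
  have y: "0 \<le> y" "y \<le> 1" "ell \<alpha> * y \<le> real m * \<alpha>" "\<alpha> / ell \<alpha> < y"
    using assms l by (auto simp: y_def min_def field_simps)
  have "x \<in> (\<Pi>\<^sub>E i\<in>{1..m}. {0..1})" using y by (auto simp: x_def)
  moreover have "{1..m} \<in> closed_Su m \<alpha> x"
    unfolding closed_Su_iff[OF assms(1)]
  proof (intro conjI ballI)
    fix S assume S: "S \<in> Pow {1..m} - {{}}"
    then have fS: "finite S" by (auto simp: finite_subset)
    have FDP: "FDP S {1..m} = card S / m"
      using S assms by (simp add: FDP_def Int_absorb1)
    show "FDP S {1..m} * max (ell \<alpha> * simes x S) \<alpha> \<le> \<alpha>"
    proof (cases "S = {m}")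
      case True
      have "simes x {m} \<le> y"
        using simes_le_of_subset[of "{m}" "{m}" x y] assms by (simp add: x_def)
      then have "ell \<alpha> * simes x {m} \<le> ell \<alpha> * y" using l by (intro mult_left_mono) auto
      moreover have "\<alpha> \<le> real m * \<alpha>" using assms by simp
      ultimately have "max (ell \<alpha> * simes x {m}) \<alpha> \<le> real m * \<alpha>" using y by linarith
      then have "max (ell \<alpha> * simes x {m}) \<alpha> / real m \<le> real m * \<alpha> / real m"
        by (rule divide_right_mono) simp
      then show ?thesis using assms True FDP by simp
    next
      case False
      \<comment> \<open>Such an \<open>S\<close> contains a zero p-value, so its Simes p-value is at
        most \<open>0\<close> and the maximum equals \<open>\<alpha>\<close>.\<close>
      then obtain j where j: "j \<in> S" "j \<noteq> m" using S by blast
      have "simes x S \<le> real (card S) * 0 / real (card {j})"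
        using j S fS by (intro simes_le_of_subset) (auto simp: x_def)
      then have "max (ell \<alpha> * simes x S) \<alpha> = \<alpha>"
        using l assms by (simp add: max_def mult_le_0_iff order_trans[of _ 0])
      moreover have "card S \<le> m" using S card_mono[of "{1..m}" S] by auto
      then have "FDP S {1..m} \<le> 1" unfolding FDP using assms by simp
      ultimately show ?thesis using assms by simp
    qed
  qed simp
  moreover have "m \<notin> Su m \<alpha> x"
  proof
    assume "m \<in> Su m \<alpha> x"
    then have "x m \<le> \<alpha> * real (Su_count m \<alpha> x) / (real m * ell \<alpha>)"
      using Su_facts(4) assms by blast
    also have "\<dots> \<le> \<alpha> * real m / (real m * ell \<alpha>)"
      using Su_facts(3)[of \<alpha> m x] assms l
      by (intro divide_right_mono mult_left_mono) auto
    also have "\<dots> = \<alpha> / ell \<alpha>" using assms by simp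
    finally show False using y assms by (simp add: x_def)
  qed
  then have "Su m \<alpha> x \<subset> {1..m}" using Su_facts(1)[OF assms(1), of m x] assms by auto
  ultimately show ?thesis by blast
qed

section \<open>The Simes inequality\<close>

text \<open>Raising coordinates can only lower the counts. Large counts form a decreasing event, so
  it is the complement that PRDN can be applied to.\<close>

lemma increasing_set_count_less:
  assumes "finite N"
  shows "increasing_set N {x \<in> space (\<Pi>\<^sub>M j\<in>N. (borel :: real measure)).
    \<not> (\<exists>r\<in>K. r \<le> card {j \<in> N. x j \<le> q r})}"
  unfolding increasing_set_def
proof (intro conjI ballI impI)
  fix x y
  assume x: "x \<in> {x \<in> space (\<Pi>\<^sub>M j\<in>N. (borel :: real measure)).
      \<not> (\<exists>r\<in>K. r \<le> card {j \<in> N. x j \<le> q r})}"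
    and y: "y \<in> (\<Pi>\<^sub>E j\<in>N. UNIV)" and le: "\<forall>j\<in>N. x j \<le> y j"
  have "card {j \<in> N. y j \<le> q r} \<le> card {j \<in> N. x j \<le> q r}" for r
    using le assms by (intro card_mono) (auto intro: order_trans)
  with x y show "y \<in> {x \<in> space (\<Pi>\<^sub>M j\<in>N. (borel :: real measure)).
      \<not> (\<exists>r\<in>K. r \<le> card {j \<in> N. x j \<le> q r})}"
    by (auto simp: space_PiM) (meson order_trans)
qed (auto simp: space_PiM)

text \<open>With \<open>G k\<close> the event that the Benjamini--Hochberg step-up count at level \<open>t\<close> is at
  least \<open>k\<close>, each event of count exactly \<open>r\<close> is charged to the \<open>r\<close> indices with
  \<open>q i \<le> r t / n\<close>. For fixed \<open>i\<close>, positive dependence makes the sum over \<open>r\<close> telescope.\<close>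

lemma (in prob_space) simes_inequality:
  fixes q :: "nat \<Rightarrow> 'a \<Rightarrow> real"
  assumes N: "finite N" "N \<noteq> {}"
    and meas: "\<And>i. i \<in> N \<Longrightarrow> q i \<in> borel_measurable M"
    and super: "\<And>i s. i \<in> N \<Longrightarrow> s \<in> {0..1} \<Longrightarrow> \<P>(\<omega> in M. q i \<omega> \<le> s) \<le> s"
    and dep: "\<And>A i. A \<in> sets (\<Pi>\<^sub>M j\<in>N. (borel :: real measure)) \<Longrightarrow> increasing_set N A \<Longrightarrow> i \<in> N \<Longrightarrow>
      mono_on {s. \<P>(\<omega> in M. q i \<omega> \<le> s) > 0}
        (\<lambda>s. \<P>(\<omega> in M. (\<lambda>j\<in>N. q j \<omega>) \<in> A \<bar> q i \<omega> \<le> s))"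
    and t: "t \<in> {0..1}"
  shows "\<P>(\<omega> in M. simes (\<lambda>j. q j \<omega>) N \<le> t) \<le> t"
proof -
  define n where "n = card N"
  have n: "0 < n" using N by (simp add: n_def card_gt_0_iff)
  define u where "u r = real r * t / real n" for r
  have u01: "u r \<in> {0..1}" if "r \<le> n" for r
    using that t n mult_mono[of "real r" "real n" t 1] by (auto simp: u_def field_simps)
  have u_mono: "u r \<le> u r'" if "r \<le> r'" for r r'
    using that t by (auto simp: u_def intro!: divide_right_mono mult_right_mono)
  \<comment> \<open>By \<open>simes_le_iff\<close>, \<open>E 1\<close> says that the Simes p-value
    of \<open>N\<close> is at most \<open>t\<close>.\<close>
  define E where "E k \<omega> \<longleftrightarrow> (\<exists>r\<in>{k..n}. r \<le> card {j \<in> N. q j \<omega> \<le> u r})" for k \<omega>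
  define G where "G k = {\<omega> \<in> space M. E k \<omega>}" for k
  define B where "B i r = {\<omega> \<in> space M. q i \<omega> \<le> u r}" for i r
  have predE: "Measurable.pred M (E k)" for k
    unfolding E_def using measurable_count_le[OF N(1) meas] by measurable
  have G [measurable]: "G k \<in> events" for k
    unfolding G_def using predE by measurable
  have B [measurable]: "B i r \<in> events" if "i \<in> N" for i r
    unfolding B_def using meas[OF that] by measurable
  have G_anti: "G (Suc k) \<subseteq> G k" for k
    unfolding G_def E_def by (auto intro: Suc_leD)
  define D where "D r = G r - G (Suc r)" for r
  have D [measurable]: "D r \<in> events" for r unfolding D_def by measurable
  \<comment> \<open>PRDN read through complements: the conditional probability of \<open>G l\<close>
    given \<open>B i k\<close> is one minus that of an increasing event, hence decreases in
    \<open>k\<close>.\<close>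
  have dep': "prob (B i k \<inter> G l) / prob (B i k) \<ge> prob (B i k' \<inter> G l) / prob (B i k')"
    if i: "i \<in> N" and "k \<le> k'" and pos: "0 < prob (B i k)" for i k k' l
  proof -
    let ?PM = "\<Pi>\<^sub>M j\<in>N. (borel :: real measure)"
    define A where "A = {x \<in> space ?PM. \<not> (\<exists>r\<in>{l..n}. r \<le> card {j \<in> N. x j \<le> u r})}"
    have "A \<in> sets ?PM"
    proof -
      have "Measurable.pred ?PM (\<lambda>x. r \<le> card {j \<in> N. x j \<le> u r})" for r
        by (intro measurable_count_le N) simp
      then show ?thesis unfolding A_def by measurable
    qed
    moreover have "increasing_set N A"
      unfolding A_def by (rule increasing_set_count_less[OF N(1)])
    ultimately have mono: "mono_on {s. \<P>(\<omega> in M. q i \<omega> \<le> s) > 0}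
        (\<lambda>s. \<P>(\<omega> in M. (\<lambda>j\<in>N. q j \<omega>) \<in> A \<bar> q i \<omega> \<le> s))"
      using dep i by blast
    have inA: "(\<lambda>j\<in>N. q j \<omega>) \<in> A \<longleftrightarrow> \<not> E l \<omega>" for \<omega>
    proof -
      have "{j \<in> N. (\<lambda>j\<in>N. q j \<omega>) j \<le> u r} = {j \<in> N. q j \<omega> \<le> u r}" for r by auto
      then show ?thesis by (simp add: A_def E_def space_PiM)
    qed
    have cond: "\<P>(\<omega> in M. (\<lambda>j\<in>N. q j \<omega>) \<in> A \<bar> q i \<omega> \<le> u r)
        = 1 - prob (B i r \<inter> G l) / prob (B i r)" if "0 < prob (B i r)" for r
    proof -
      have "{\<omega> \<in> space M. \<not> E l \<omega> \<and> q i \<omega> \<le> u r} = B i r - (B i r \<inter> G l)"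
        by (auto simp: B_def G_def)
      then have "\<P>(\<omega> in M. \<not> E l \<omega> \<and> q i \<omega> \<le> u r) = prob (B i r) - prob (B i r \<inter> G l)"
        using B[OF i] by (simp add: finite_measure_Diff)
      then show ?thesis
        using that by (simp add: cond_prob_def inA diff_divide_distrib flip: B_def)
    qed
    have "prob (B i k) \<le> prob (B i k')"
      using u_mono[OF \<open>k \<le> k'\<close>] B[OF i] by (intro finite_measure_mono) (auto simp: B_def)
    with pos have pos': "0 < prob (B i k')" by simp
    have "\<P>(\<omega> in M. (\<lambda>j\<in>N. q j \<omega>) \<in> A \<bar> q i \<omega> \<le> u k)
        \<le> \<P>(\<omega> in M. (\<lambda>j\<in>N. q j \<omega>) \<in> A \<bar> q i \<omega> \<le> u k')"
      using pos pos' u_mono[OF \<open>k \<le> k'\<close>] unfolding B_def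
      by (intro mono_onD[OF mono]) auto
    then show ?thesis unfolding cond[OF pos] cond[OF pos'] by simp
  qed
  \<comment> \<open>Downward induction from the empty sum at \<open>k = Suc n\<close>. The invariant
    is \<open>t / n\<close> times the conditional probability of \<open>G k\<close> given
    \<open>B i k\<close>, with default \<open>1\<close>, the largest possible value, when
    \<open>B i k\<close> is null.\<close>
  have tele: "(\<Sum>r\<in>{k..n}. prob (B i r \<inter> D r) / real r) \<le> t / real n *
      (if 0 < prob (B i k) then prob (B i k \<inter> G k) / prob (B i k) else 1)"
    if i: "i \<in> N" and k: "1 \<le> k" "k \<le> Suc n" for i k
    using k(2,1)
  proof (induction k rule: inc_induct)
    case base
    show ?case using t by simp
  next
    case (step k)
    have sum: "(\<Sum>r\<in>{k..n}. prob (B i r \<inter> D r) / real r)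
        = prob (B i k \<inter> D k) / real k + (\<Sum>r\<in>{Suc k..n}. prob (B i r \<inter> D r) / real r)"
      using step.hyps by (subst sum.atLeast_Suc_atMost) auto
    let ?C = "if 0 < prob (B i (Suc k)) then prob (B i (Suc k) \<inter> G (Suc k)) / prob (B i (Suc k)) else 1"
    have IH: "(\<Sum>r\<in>{Suc k..n}. prob (B i r \<inter> D r) / real r) \<le> t / real n * ?C"
      using step.IH by simp
    show ?case
    proof (cases "0 < prob (B i k)")
      case False
      then have 0: "prob (B i k) = 0" by (simp add: zero_less_measure_iff)
      have "prob (B i k \<inter> D k) \<le> prob (B i k)"
        using B[OF i] by (intro finite_measure_mono) auto
      then have "prob (B i k \<inter> D k) = 0" using 0 by (simp add: antisym)
      moreover have "?C \<le> 1"
        using finite_measure_mono[of "B i (Suc k) \<inter> G (Suc k)" "B i (Suc k)"] B[OF i]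
        by (auto simp: divide_le_eq)
      then have "t / real n * ?C \<le> t / real n * 1"
        using t by (intro mult_left_mono) auto
      ultimately show ?thesis using IH False unfolding sum by simp
    next
      case True
      have "prob (B i k) \<le> prob (B i (Suc k))"
        using u_mono[of k "Suc k"] B[OF i] by (intro finite_measure_mono) (auto simp: B_def)
      with True have "0 < prob (B i (Suc k))" by simp
      \<comment> \<open>Dependence moves the conditioning from \<open>B i (Suc k)\<close> down to
        \<open>B i k\<close>. The new term then contributes the difference between the conditional
        probabilities of \<open>G k\<close> and \<open>G (Suc k)\<close> given the same
        event.\<close>
      then have "?C \<le> prob (B i k \<inter> G (Suc k)) / prob (B i k)"
        using dep'[OF i _ True, of "Suc k" "Suc k"] by simp
      then have 1: "t / real n * ?C \<le> t / real n * (prob (B i k \<inter> G (Suc k)) / prob (B i k))"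
        using t by (intro mult_left_mono) auto
      have "B i k \<inter> D k = (B i k \<inter> G k) - (B i k \<inter> G (Suc k))" by (auto simp: D_def)
      then have 2: "prob (B i k \<inter> D k) = prob (B i k \<inter> G k) - prob (B i k \<inter> G (Suc k))"
        using B[OF i, of k] G_anti[of k] by (simp only:) (intro finite_measure_Diff; auto)
      \<comment> \<open>Superuniformity replaces \<open>1 / k\<close> by
        \<open>(u k / k) / prob (B i k)\<close>; since \<open>u\<close> is linear,
        \<open>u k / k = t / n\<close> does not depend on \<open>k\<close>.\<close>
      have "prob (B i k) \<le> u k"
        unfolding B_def using step.hyps u01[of k] i by (intro super) auto
      then have "prob (B i k \<inter> D k) / real k
          \<le> u k / real k * (prob (B i k \<inter> D k) / prob (B i k))"
        using True step.prems
        by (simp add: field_simps mult_right_mono)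
      also have "u k / real k = t / real n" using step.prems by (simp add: u_def)
      finally show ?thesis
        using IH 1 True unfolding sum 2 by (simp add: diff_divide_distrib right_diff_distrib)
    qed
  qed
  have charge: "prob (D r) \<le> (\<Sum>i\<in>N. prob (B i r \<inter> D r) / real r)" if r: "1 \<le> r" "r \<le> n" for r
  proof -
    have "real r * indicator (D r) \<omega> \<le> (\<Sum>i\<in>N. indicator (B i r \<inter> D r) \<omega> :: real)" for \<omega>
    proof (cases "\<omega> \<in> D r")
      case True
      then have "\<omega> \<in> space M" "E r \<omega>" "\<not> E (Suc r) \<omega>" by (auto simp: D_def G_def)
      \<comment> \<open>\<open>E r\<close> has a witness in \<open>{r..n}\<close> and
        \<open>E (Suc r)\<close> has none in \<open>{Suc r..n}\<close>, so the witness is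
        \<open>r\<close> itself.\<close>
      then have "r \<le> card {j \<in> N. q j \<omega> \<le> u r}"
        unfolding E_def by (metis Suc_leI atLeastAtMost_iff order_le_imp_less_or_eq)
      also have "{j \<in> N. q j \<omega> \<le> u r} = {i \<in> N. \<omega> \<in> B i r \<inter> D r}"
        using True \<open>\<omega> \<in> space M\<close> by (auto simp: B_def)
      finally show ?thesis
        using True N(1) by (simp add: indicator_def sum.If_cases Int_def)
    qed (auto intro: sum_nonneg)
    then have "(\<integral>\<omega>. real r * indicator (D r) \<omega> \<partial>M)
        \<le> (\<integral>\<omega>. (\<Sum>i\<in>N. indicator (B i r \<inter> D r) \<omega>) \<partial>M)"
      using B by (intro integral_mono Bochner_Integration.integrable_sum)
        (auto intro!: integrable_real_indicator simp: emeasure_eq_measure)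
    also have "\<dots> = (\<Sum>i\<in>N. prob (B i r \<inter> D r))"
      using B by (subst Bochner_Integration.integral_sum)
        (auto intro!: integrable_real_indicator simp: emeasure_eq_measure)
    finally have "real r * prob (D r) \<le> (\<Sum>i\<in>N. prob (B i r \<inter> D r))" by simp
    then show ?thesis using r by (simp add: field_simps flip: sum_divide_distrib)
  qed
  \<comment> \<open>The differences telescope down to \<open>G (Suc n)\<close>, which is empty
    because no \<open>r\<close> lies in \<open>{Suc n..n}\<close>.\<close>
  have "prob (G 1) = (\<Sum>r\<in>{1..n}. prob (D r))"
  proof -
    have "prob (D r) = prob (G r) - prob (G (Suc r))" for r
      unfolding D_def using G_anti by (intro finite_measure_Diff) auto
    then have "(\<Sum>r\<in>{1..n}. prob (D r)) = (\<Sum>r\<in>{1..n}. prob (G r) - prob (G (Suc r)))" by simp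
    also have "\<dots> = prob (G 1) - prob (G (Suc n))"
      using n sum_Suc_diff[of 1 n "\<lambda>r. - prob (G r)"] by simp
    also have "G (Suc n) = {}" by (simp add: G_def E_def)
    finally show ?thesis by simp
  qed
  also have "\<dots> \<le> (\<Sum>r\<in>{1..n}. \<Sum>i\<in>N. prob (B i r \<inter> D r) / real r)"
    by (intro sum_mono charge) auto
  also have "\<dots> = (\<Sum>i\<in>N. \<Sum>r\<in>{1..n}. prob (B i r \<inter> D r) / real r)"
    by (rule sum.swap)
  also have "\<dots> \<le> (\<Sum>i\<in>N. t / real n)"
  proof (rule sum_mono)
    fix i assume i: "i \<in> N"
    have "(if 0 < prob (B i 1) then prob (B i 1 \<inter> G 1) / prob (B i 1) else 1) \<le> 1"
      using finite_measure_mono[of "B i 1 \<inter> G 1" "B i 1"] B[OF i]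
      by (auto simp: divide_le_eq)
    then have "t / real n * (if 0 < prob (B i 1) then prob (B i 1 \<inter> G 1) / prob (B i 1) else 1)
        \<le> t / real n * 1"
      using t by (intro mult_left_mono) auto
    then show "(\<Sum>r\<in>{1..n}. prob (B i r \<inter> D r) / real r) \<le> t / real n"
      using tele[OF i, of 1] by simp
  qed
  also have "\<dots> = t" using n by (simp add: n_def)
  finally show ?thesis
    unfolding simes_le_iff[OF N] by (simp add: G_def E_def u_def n_def)
qed

section \<open>Simultaneous FDR control\<close>

text \<open>The bound is the expectation for a uniformly distributed \<open>X\<close>. It follows from the
  layer-cake identity
  \<open>1 / max (l X) a = 1 / l + \<integral> u \<in> [a / l, 1]. [X \<le> u] / (l u\<^sup>2)\<close> for \<open>X \<le> 1\<close>.\<close>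

lemma (in prob_space) expectation_inverse_max_le:
  fixes X :: "'a \<Rightarrow> real"
  assumes X [measurable]: "X \<in> borel_measurable M"
    and X1: "\<And>\<omega>. \<omega> \<in> space M \<Longrightarrow> X \<omega> \<le> 1"
    and super: "\<And>s. s \<in> {0..1} \<Longrightarrow> \<P>(\<omega> in M. X \<omega> \<le> s) \<le> s"
    and a: "0 < a" "a \<le> l"
  shows "integrable M (\<lambda>\<omega>. inverse (max (l * X \<omega>) a))"
    "expectation (\<lambda>\<omega>. inverse (max (l * X \<omega>) a)) \<le> (1 + ln (l / a)) / l"
proof -
  interpret pair_sigma_finite M lborel ..
  define c where "c = a / l"
  have l: "0 < l" using a by simp
  have c: "0 < c" "c \<le> 1" using a by (auto simp: c_def)
  define f where "f u = 1 / (l * u\<^sup>2)" for u :: real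
  define g where "g \<omega> u = ennreal (f u) * indicator {c..1} u * indicator {X \<omega>..} u" for \<omega> u
  have f [measurable]: "f \<in> borel_measurable borel" unfolding f_def by measurable
  \<comment> \<open>Joint measurability is shown with a comparison of \<open>X \<omega>\<close> and
    \<open>u\<close> in place of the indicator of the random set
    \<open>{X \<omega>..}\<close>.\<close>
  have "(\<lambda>(\<omega>, u). ennreal (f u) * indicator {c..1} u * (if X \<omega> \<le> u then 1 else 0))
      \<in> borel_measurable (M \<Otimes>\<^sub>M lborel)"
    by measurable
  then have g: "case_prod g \<in> borel_measurable (M \<Otimes>\<^sub>M lborel)"
    by (rule measurable_cong[THEN iffD1, rotated]) (auto simp: g_def indicator_def)
  have layer: "ennreal (inverse (max (l * X \<omega>) a)) = ennreal (1 / l) + (\<integral>\<^sup>+u. g \<omega> u \<partial>lborel)"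
    if "\<omega> \<in> space M" for \<omega>
  proof -
    \<comment> \<open>The two indicators in \<open>g\<close> cut the integral to
      \<open>{b..1}\<close>, where the antiderivative \<open>- 1 / (l * u)\<close> gives
      \<open>1 / (l * b) - 1 / l\<close>.\<close>
    define b where "b = max c (X \<omega>)"
    have b: "0 < b" "b \<le> 1" using c X1[OF that] by (auto simp: b_def)
    have "max (l * X \<omega>) a = l * b"
      using l by (auto simp: b_def c_def max_def field_simps)
    have "(\<integral>\<^sup>+u. g \<omega> u \<partial>lborel) = (\<integral>\<^sup>+u. ennreal (f u) * indicator {b..1} u \<partial>lborel)"
      by (intro nn_integral_cong) (auto simp: g_def b_def indicator_def)
    also have "\<dots> = ennreal (- (1 / (l * 1)) - - (1 / (l * b)))"
    proof (rule nn_integral_FTC_Icc)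
      fix u assume "u \<in> {b..1}"
      then have "0 < u" using b by auto
      then show "((\<lambda>u. - (1 / (l * u))) has_real_derivative f u) (at u)" "0 \<le> f u"
        using l by (auto intro!: derivative_eq_intros simp: f_def field_simps power2_eq_square)
    qed (use b in auto)
    also have "ennreal (1 / l) + \<dots> = ennreal (1 / l + (- (1 / (l * 1)) - - (1 / (l * b))))"
      using b l by (intro ennreal_plus[symmetric]) (auto simp: field_simps)
    also have "\<dots> = ennreal (inverse (max (l * X \<omega>) a))"
      using \<open>max (l * X \<omega>) a = l * b\<close> by (simp add: inverse_eq_divide)
    finally show ?thesis by simp
  qed
  \<comment> \<open>For fixed \<open>u\<close>, integrating over the sample space leaves
    \<open>f u\<close> times the probability of \<open>X \<le> u\<close>, which is at most
    \<open>u\<close>; one power of \<open>u\<close> cancels.\<close>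
  have slice: "(\<integral>\<^sup>+\<omega>. g \<omega> u \<partial>M) \<le> ennreal (1 / (l * u)) * indicator {c..1} u" for u
  proof (cases "u \<in> {c..1}")
    case True
    have "(\<integral>\<^sup>+\<omega>. g \<omega> u \<partial>M) = (\<integral>\<^sup>+\<omega>. ennreal (f u) * indicator {\<omega> \<in> space M. X \<omega> \<le> u} \<omega> \<partial>M)"
      using True by (intro nn_integral_cong) (auto simp: g_def indicator_def)
    also have "\<dots> = ennreal (f u) * ennreal \<P>(\<omega> in M. X \<omega> \<le> u)"
      by (simp add: nn_integral_cmult_indicator emeasure_eq_measure)
    also have "\<dots> \<le> ennreal (f u) * ennreal u"
      using super[of u] True c by (intro mult_left_mono ennreal_leI) auto
    also have "\<dots> = ennreal (1 / (l * u))"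
      using True c l by (subst ennreal_mult[symmetric]) (auto simp: f_def power2_eq_square)
    finally show ?thesis using True by simp
  qed (simp add: g_def)
  have "(\<integral>\<^sup>+\<omega>. ennreal (inverse (max (l * X \<omega>) a)) \<partial>M)
      = (\<integral>\<^sup>+\<omega>. ennreal (1 / l) + (\<integral>\<^sup>+u. g \<omega> u \<partial>lborel) \<partial>M)"
    by (intro nn_integral_cong layer)
  also have "\<dots> = ennreal (1 / l) + (\<integral>\<^sup>+\<omega>. \<integral>\<^sup>+u. g \<omega> u \<partial>lborel \<partial>M)"
    using lborel.borel_measurable_nn_integral[OF g]
    by (subst nn_integral_add) (auto simp: emeasure_space_1)
  also have "(\<integral>\<^sup>+\<omega>. \<integral>\<^sup>+u. g \<omega> u \<partial>lborel \<partial>M) = (\<integral>\<^sup>+u. \<integral>\<^sup>+\<omega>. g \<omega> u \<partial>M \<partial>lborel)"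
    by (rule Fubini'[OF g, symmetric])
  also have "\<dots> \<le> (\<integral>\<^sup>+u. ennreal (1 / (l * u)) * indicator {c..1} u \<partial>lborel)"
    by (intro nn_integral_mono slice)
  \<comment> \<open>The antiderivative is \<open>ln u / l\<close>, and
    \<open>- ln c = ln (l / a)\<close>.\<close>
  also have "\<dots> = ennreal (ln 1 / l - ln c / l)"
    using c l
    by (intro nn_integral_FTC_Icc)
      (auto intro!: derivative_eq_intros simp: field_simps)
  also have "ennreal (1 / l) + \<dots> = ennreal ((1 + ln (l / a)) / l)"
    using c l a by (subst ennreal_plus[symmetric])
      (auto simp: c_def ln_div add_divide_distrib diff_divide_distrib divide_right_mono)
  finally have nn: "(\<integral>\<^sup>+\<omega>. ennreal (inverse (max (l * X \<omega>) a)) \<partial>M) \<le> ennreal ((1 + ln (l / a)) / l)"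
    by (simp add: add_left_mono)
  have nonneg: "0 \<le> inverse (max (l * X \<omega>) a)" for \<omega> using a by simp
  show int: "integrable M (\<lambda>\<omega>. inverse (max (l * X \<omega>) a))"
    using nn nonneg by (intro integrableI_nonneg) (auto intro: le_less_trans[OF nn])
  have "0 \<le> (1 + ln (l / a)) / l" using a by simp
  with nn show "expectation (\<lambda>\<omega>. inverse (max (l * X \<omega>) a)) \<le> (1 + ln (l / a)) / l"
    using nn_integral_eq_integral[OF int] nonneg by (simp add: ennreal_le_iff)
qed

lemma closed_Su_controls_FDR:
  fixes P :: "'a measure" and p :: "nat \<Rightarrow> 'a \<Rightarrow> real"
  assumes P: "prob_space P" and N: "N \<subseteq> {1..m}" and \<alpha>: "0 < \<alpha>" "\<alpha> \<le> 1"
    and meas: "\<And>i. i \<in> {1..m} \<Longrightarrow> p i \<in> borel_measurable P"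
    and p01: "\<And>i \<omega>. i \<in> {1..m} \<Longrightarrow> \<omega> \<in> space P \<Longrightarrow> p i \<omega> \<in> {0..1}"
    and super: "\<And>i s. i \<in> N \<Longrightarrow> s \<in> {0..1} \<Longrightarrow> \<P>(\<omega> in P. p i \<omega> \<le> s) \<le> s"
    and dep: "\<And>A i. A \<in> sets (\<Pi>\<^sub>M j\<in>N. (borel :: real measure)) \<Longrightarrow> increasing_set N A \<Longrightarrow> i \<in> N \<Longrightarrow>
      mono_on {s. \<P>(\<omega> in P. p i \<omega> \<le> s) > 0}
        (\<lambda>s. \<P>(\<omega> in P. (\<lambda>j\<in>N. p j \<omega>) \<in> A \<bar> p i \<omega> \<le> s))"
  shows "integrable P (\<lambda>\<omega>. max_FDP N (closed_Su m \<alpha> (\<lambda>i\<in>{1..m}. p i \<omega>)))"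
    "(\<integral>\<omega>. max_FDP N (closed_Su m \<alpha> (\<lambda>i\<in>{1..m}. p i \<omega>)) \<partial>P) \<le> \<alpha>"
proof -
  interpret P: prob_space P by (rule P)
  define C where "C \<omega> = closed_Su m \<alpha> (\<lambda>i\<in>{1..m}. p i \<omega>)" for \<omega>
  have C_sub: "C \<omega> \<subseteq> Pow {1..m}" for \<omega> by (auto simp: C_def closed_Su_def)
  have C_empty: "{} \<in> C \<omega>" for \<omega> unfolding C_def using \<alpha> by (rule_tac empty_in_closed_Su)
  have C_fin: "finite (C \<omega>)" for \<omega> using C_sub[of \<omega>] by (rule finite_subset) simp
  have max_le: "max_FDP N (C \<omega>) \<le> b" if "\<And>R. R \<in> C \<omega> \<Longrightarrow> FDP N R \<le> b" for \<omega> b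
    unfolding max_FDP_def using that C_empty[of \<omega>] C_fin[of \<omega>] by (subst Max_le_iff) auto
  have max_ge: "0 \<le> max_FDP N (C \<omega>)" for \<omega>
    unfolding max_FDP_def using C_empty[of \<omega>] C_fin[of \<omega>]
    by (intro Max_ge_iff[THEN iffD2] bexI[of _ "FDP N {}"] imageI) auto
  \<comment> \<open>With \<open>max_ge\<close> and measurability this bound gives integrability on a
    probability space.\<close>
  have max_le_1: "max_FDP N (C \<omega>) \<le> 1" for \<omega>
  proof (rule max_le)
    fix R assume "R \<in> C \<omega>"
    then have "finite R" using C_sub[of \<omega>] by (auto intro: finite_subset)
    then have "card (R \<inter> N) \<le> card R" by (intro card_mono) auto
    then show "FDP N R \<le> 1" by (simp add: FDP_def)
  qed
  have meas': "(\<lambda>\<omega>. max_FDP N (C \<omega>)) \<in> borel_measurable P"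
    using C_empty C_sub
  proof (rule borel_measurable_max_FDP)
    fix R :: "nat set"
    show "{\<omega> \<in> space P. R \<in> C \<omega>} \<in> sets P"
      unfolding C_def using \<alpha>(1) meas by (intro closed_Su_measurable) auto
  qed
  show int: "integrable P (\<lambda>\<omega>. max_FDP N (closed_Su m \<alpha> (\<lambda>i\<in>{1..m}. p i \<omega>)))"
    unfolding C_def[symmetric]
    using meas' max_ge max_le_1 by (intro P.integrable_const_bound[where B = 1]) auto
  show "(\<integral>\<omega>. max_FDP N (closed_Su m \<alpha> (\<lambda>i\<in>{1..m}. p i \<omega>)) \<partial>P) \<le> \<alpha>"
  proof (cases "N = {}")
    \<comment> \<open>Without true nulls every \<open>FDP\<close> is \<open>0\<close>; this is split
      off because the Simes bounds need a nonempty set.\<close>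
    case True
    have "max_FDP N (C \<omega>) = 0" for \<omega>
      using True max_ge[of \<omega>] max_le[of \<omega> 0] by (intro antisym) auto
    then show ?thesis using \<alpha> unfolding C_def[symmetric] by simp
  next
    case False
    have finN: "finite N" using N by (rule finite_subset) simp
    have l: "1 \<le> ell \<alpha>" using ell_props \<alpha> by blast
    let ?s = "\<lambda>\<omega>. simes (\<lambda>j. p j \<omega>) N"
    have s: "?s \<in> borel_measurable P" "\<And>\<omega>. \<omega> \<in> space P \<Longrightarrow> ?s \<omega> \<le> 1"
      "\<And>t. t \<in> {0..1} \<Longrightarrow> \<P>(\<omega> in P. ?s \<omega> \<le> t) \<le> t"
      using finN False N meas p01 super dep
      by (auto intro!: borel_measurable_simes simes_le_one P.simes_inequality)
    have aux: "integrable P (\<lambda>\<omega>. inverse (max (ell \<alpha> * ?s \<omega>) \<alpha>))"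
      "P.expectation (\<lambda>\<omega>. inverse (max (ell \<alpha> * ?s \<omega>) \<alpha>)) \<le> (1 + ln (ell \<alpha> / \<alpha>)) / ell \<alpha>"
      using P.expectation_inverse_max_le[OF s] \<alpha> l by auto
    have pointwise: "max_FDP N (C \<omega>) \<le> \<alpha> * inverse (max (ell \<alpha> * ?s \<omega>) \<alpha>)" for \<omega>
    proof (rule max_le)
      fix R assume "R \<in> C \<omega>"
      then have "FDP N R * max (ell \<alpha> * simes (\<lambda>i\<in>{1..m}. p i \<omega>) N) \<alpha> \<le> \<alpha>"
        using False N unfolding C_def closed_Su_iff[OF \<alpha>(1)] by blast
      moreover have "simes (\<lambda>i\<in>{1..m}. p i \<omega>) N = ?s \<omega>"
        using finN N by (intro simes_cong) auto
      moreover have "0 < max (ell \<alpha> * ?s \<omega>) \<alpha>" using \<alpha> by auto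
      ultimately show "FDP N R \<le> \<alpha> * inverse (max (ell \<alpha> * ?s \<omega>) \<alpha>)"
        by (simp add: field_simps)
    qed
    have "(\<integral>\<omega>. max_FDP N (C \<omega>) \<partial>P) \<le> (\<integral>\<omega>. \<alpha> * inverse (max (ell \<alpha> * ?s \<omega>) \<alpha>) \<partial>P)"
      using int aux(1) pointwise by (intro integral_mono) (auto simp: C_def)
    also have "\<dots> \<le> \<alpha> * ((1 + ln (ell \<alpha> / \<alpha>)) / ell \<alpha>)"
      using mult_left_mono[OF aux(2), of \<alpha>] \<alpha> by simp
    \<comment> \<open>The defining property of \<open>ell \<alpha>\<close> makes the factor
      \<open>(1 + ln (ell \<alpha> / \<alpha>)) / ell \<alpha>\<close> equal to
      \<open>1\<close>.\<close>
    also have "\<dots> = \<alpha>" using ell_eq[OF \<alpha>] l by simp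
    finally show ?thesis by (simp add: C_def)
  qed
qed

theorem theorem34:
  fixes \<Omega> :: "'a measure" and M :: "'a measure set" and m :: nat
    and H :: "nat \<Rightarrow> 'a measure set" and p :: "nat \<Rightarrow> 'a \<Rightarrow> real" and \<alpha> :: real
  assumes "\<And>P. P \<in> M \<Longrightarrow> prob_space P \<and> sets P = sets \<Omega>"
    and "m \<ge> 1"
    and "\<And>i. i \<in> {1..m} \<Longrightarrow> H i \<subseteq> M"
    and "0 < \<alpha>" and "\<alpha> \<le> 1"
    and "\<And>i. i \<in> {1..m} \<Longrightarrow> is_p_value \<Omega> (H i) (p i)"
  shows "(PRDN M m H p \<longrightarrow>
            controls_FDR_simultaneously M m H (\<lambda>\<omega>. closed_Su m \<alpha> (\<lambda>i\<in>{1..m}. p i \<omega>)) \<alpha>) \<and>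
         (\<alpha> < 1 \<and> m > 1 \<longrightarrow>
            uniform_power_improvement (\<Pi>\<^sub>E i\<in>{1..m}. {0..1}) (closed_Su m \<alpha>) (Su m \<alpha>) \<and>
            uniform_simultaneity_improvement (\<Pi>\<^sub>E i\<in>{1..m}. {0..1}) (closed_Su m \<alpha>) (Su m \<alpha>))"
proof (intro conjI impI)
  assume PRDN: "PRDN M m H p"
  show "controls_FDR_simultaneously M m H (\<lambda>\<omega>. closed_Su m \<alpha> (\<lambda>i\<in>{1..m}. p i \<omega>)) \<alpha>"
    unfolding controls_FDR_simultaneously_def
  proof (rule ballI)
    fix P assume PM: "P \<in> M"
    let ?N = "true_nulls m H P"
    have P: "prob_space P" "sets P = sets \<Omega>" using assms(1)[OF PM] by auto
    have sp: "space P = space \<Omega>" using P(2) by (rule sets_eq_imp_space_eq)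
    have N: "?N \<subseteq> {1..m}" by (auto simp: true_nulls_def)
    have meas: "p i \<in> borel_measurable P" if "i \<in> {1..m}" for i
      using assms(6)[OF that] measurable_cong_sets[OF P(2) refl, of "borel :: real measure"]
      by (simp add: is_p_value_def)
    have p01: "p i \<omega> \<in> {0..1}" if "i \<in> {1..m}" "\<omega> \<in> space P" for i \<omega>
      using assms(6)[OF that(1)] that(2) unfolding is_p_value_def sp by blast
    have super: "\<P>(\<omega> in P. p i \<omega> \<le> s) \<le> s" if "i \<in> ?N" "s \<in> {0..1}" for i s
      using assms(6)[of i] that unfolding is_p_value_def true_nulls_def by blast
    have dep: "mono_on {s. \<P>(\<omega> in P. p i \<omega> \<le> s) > 0}
        (\<lambda>s. \<P>(\<omega> in P. (\<lambda>j\<in>?N. p j \<omega>) \<in> A \<bar> p i \<omega> \<le> s))"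
      if "A \<in> sets (\<Pi>\<^sub>M j\<in>?N. (borel :: real measure))" "increasing_set ?N A" "i \<in> ?N" for A i
      using PRDN PM that unfolding PRDN_def Let_def by blast
    show "integrable P (\<lambda>\<omega>. max_FDP ?N (closed_Su m \<alpha> (\<lambda>i\<in>{1..m}. p i \<omega>))) \<and>
        (\<integral>\<omega>. max_FDP ?N (closed_Su m \<alpha> (\<lambda>i\<in>{1..m}. p i \<omega>)) \<partial>P) \<le> \<alpha>"
      using closed_Su_controls_FDR[OF P(1) N assms(4,5) meas p01 super dep] by blast
  qed
next
  assume "\<alpha> < 1 \<and> 1 < m"
  \<comment> \<open>One realization serves both claims: \<open>{1..m}\<close> is a nonempty proper
    superset of the Su set, hence also different from it.\<close>
  then obtain x where x: "x \<in> (\<Pi>\<^sub>E i\<in>{1..m}. {0..1})" "{1..m} \<in> closed_Su m \<alpha> x"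
    "Su m \<alpha> x \<subset> {1..m}"
    using strict_improvement_exists[OF assms(4)] by blast
  have ne: "{1..m} \<noteq> {}" using assms(2) by simp
  note Su = Su_in_closed_Su[OF assms(4,5)]
  show "uniform_power_improvement (\<Pi>\<^sub>E i\<in>{1..m}. {0..1}) (closed_Su m \<alpha>) (Su m \<alpha>)"
    unfolding uniform_power_improvement_def using x ne Su by blast
  show "uniform_simultaneity_improvement (\<Pi>\<^sub>E i\<in>{1..m}. {0..1}) (closed_Su m \<alpha>) (Su m \<alpha>)"
    unfolding uniform_simultaneity_improvement_def using x ne Su by blast
qed

end
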